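(* Let $S$ be a $*$-monoid and let $a,w\in S$. Then $a$ is $w$-core invertible if and only if $w$ is invertible along $a$ and $a$ has a $\{1,3\}$-inverse. In this case, writing $a_w^{\#}$ for the $w$-core inverse of $a$, one has $a_w^{\#}=w^{\parallel a}a^{(1,3)}$ and $w^{\parallel a}=a_w^{\#}a$.
   Context: A $*$-monoid is a semigroup $S$ with identity $1$ and a map $*$ satisfying $(x^* )^*=x$ and $(xy)^*=y^*x^*$ for all $x,y\in S$. For $a,w\in S$, $a$ is $w$-core invertible if there exists $x\in S$ with $awx^2=x$, $xawa=a$ and $(awx)^*=awx$. Such an $x$ is called a $w$-core inverse of $a$; it is unique if it exists and is denoted here by $a_w^{\#}$. For $a,d\in S$, $a$ is invertible along $d$ if there exists $b\in S$ with $bad=d=dab$ and $b\in dS\cap Sd$. Such a $b$ is unique if it exists and is denoted $a^{\parallel d}$. A $\{1,3\}$-inverse of $a$ is an $x\in S$ with $axa=a$ and $(ax)^*=ax$; $a^{(1,3)}$ denotes an arbitrary $\{1,3\}$-inverse of $a$. *)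

theory Defs
  imports Main
begin

class star_monoid = monoid_mult +
  fixes star :: "'a \<Rightarrow> 'a"
  assumes star_star: "star (star x) = x"
    and star_mult: "star (x * y) = star y * star x"

definition is_w_core_inverse :: "'a::star_monoid \<Rightarrow> 'a \<Rightarrow> 'a \<Rightarrow> bool" where
  "is_w_core_inverse w a x \<longleftrightarrow>
     a * w * x ^ 2 = x \<and> x * a * w * a = a \<and> star (a * w * x) = a * w * x"

definition w_core_invertible :: "'a::star_monoid \<Rightarrow> 'a \<Rightarrow> bool" where
  "w_core_invertible w a \<longleftrightarrow> (\<exists>x. is_w_core_inverse w a x)"

(* Meaningful only if a is w-core invertible; see is_w_core_inverse_unique. *)
definition w_core_inverse :: "'a::star_monoid \<Rightarrow> 'a \<Rightarrow> 'a" where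
  "w_core_inverse w a = (THE x. is_w_core_inverse w a x)"

(* b is an inverse of a along d. *)
definition is_inverse_along :: "'a::monoid_mult \<Rightarrow> 'a \<Rightarrow> 'a \<Rightarrow> bool" where
  "is_inverse_along a d b \<longleftrightarrow>
     b * a * d = d \<and> d = d * a * b \<and> b \<in> range (\<lambda>s. d * s) \<inter> range (\<lambda>s. s * d)"

definition invertible_along :: "'a::monoid_mult \<Rightarrow> 'a \<Rightarrow> bool" where
  "invertible_along a d \<longleftrightarrow> (\<exists>b. is_inverse_along a d b)"

(* Meaningful only if a is invertible along d; see is_inverse_along_unique. *)
definition inverse_along :: "'a::monoid_mult \<Rightarrow> 'a \<Rightarrow> 'a" where
  "inverse_along a d = (THE b. is_inverse_along a d b)"

definition is_13_inverse :: "'a::star_monoid \<Rightarrow> 'a \<Rightarrow> bool" where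
  "is_13_inverse a x \<longleftrightarrow> a * x * a = a \<and> star (a * x) = a * x"

lemma is_inverse_along_unique:
  assumes "is_inverse_along a d b" and "is_inverse_along a d c"
  shows "b = c"
proof -
  obtain s where s: "b = d * s"
    using assms(1) by (auto simp: is_inverse_along_def)
  obtain t where t: "c = t * d"
    using assms(2) by (auto simp: is_inverse_along_def)
  have "c * a * b = c * a * d * s"
    by (simp add: s mult.assoc)
  also have "\<dots> = b"
    using assms(2) by (simp add: is_inverse_along_def s)
  finally have 1: "c * a * b = b" .
  have "c * a * b = t * (d * a * b)"
    by (simp add: t mult.assoc)
  also have "\<dots> = c"
    using assms(1) by (simp add: is_inverse_along_def t)
  finally show ?thesis using 1 by simp
qed

lemma is_w_core_inverse_unique:
  assumes "is_w_core_inverse w a x" and "is_w_core_inverse w a y"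
  shows "x = y"
proof -
  have absorb: "u * a * w * v = v"
    if "is_w_core_inverse w a u" "is_w_core_inverse w a v" for u v
  proof -
    have "u * a * w * v = u * a * w * (a * w * v ^ 2)"
      using that(2) by (simp add: is_w_core_inverse_def)
    also have "\<dots> = (u * a * w * a) * w * v ^ 2"
      by (simp add: mult.assoc)
    also have "\<dots> = v"
      using that by (simp add: is_w_core_inverse_def)
    finally show ?thesis .
  qed
  have inner: "a * w * u * a = a" if "is_w_core_inverse w a u" for u
  proof -
    have "a * w * u * a = a * w * u * (u * a * w * a)"
      using that by (simp add: is_w_core_inverse_def)
    also have "\<dots> = (a * w * u ^ 2) * a * w * a"
      by (simp add: mult.assoc power2_eq_square)
    also have "\<dots> = a"
      using that by (simp add: is_w_core_inverse_def)
    finally show ?thesis .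
  qed
  have prod: "(a * w * u) * (a * w * v) = a * w * v"
    if "is_w_core_inverse w a u" for u v
    using inner[OF that] by (metis mult.assoc)
  have "a * w * y = star ((a * w * x) * (a * w * y))"
    using prod[OF assms(1)] assms(2) by (simp add: is_w_core_inverse_def)
  also have "\<dots> = (a * w * y) * (a * w * x)"
    using assms by (simp add: star_mult[of "a * w * x"] is_w_core_inverse_def)
  also have "\<dots> = a * w * x"
    by (rule prod[OF assms(2)])
  finally have "a * w * y = a * w * x" .
  then have "x * a * w * x = x * a * w * y"
    by (simp add: mult.assoc)
  then show ?thesis
    using absorb[OF assms(1) assms(1)] absorb[OF assms] by simp
qed

end

theory Submission
  imports Defs
begin

text \<open>The two kinds of data convert into each other by explicit formulas. A w-core inverse
  \<open>x\<close> of \<open>a\<close> yields the inverse \<open>x * a\<close> of \<open>w\<close>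
  along \<open>a\<close> and the {1,3}-inverse \<open>w * x\<close> of \<open>a\<close>; both rest
  on \<open>a * w * x * a = a\<close> (\<open>w_core_inverse_inner\<close>). Conversely, if
  \<open>b\<close> inverts \<open>w\<close> along \<open>a\<close> and \<open>y\<close> is any
  {1,3}-inverse of \<open>a\<close>, then \<open>b * y\<close> is a w-core inverse
  (\<open>is_w_core_inverse_along_13\<close>), since \<open>a * w * b = a\<close> turns
  \<open>a * w * (b * y)\<close> into the Hermitian idempotent \<open>a * y\<close>. Uniqueness of
  both inverses then gives the two formulas.\<close>

lemma w_core_inverse_eq: "is_w_core_inverse w a x \<Longrightarrow> w_core_inverse w a = x"
  unfolding w_core_inverse_def by (blast intro: is_w_core_inverse_unique)

lemma inverse_along_eq: "is_inverse_along w a b \<Longrightarrow> inverse_along w a = b"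
  unfolding inverse_along_def by (blast intro: is_inverse_along_unique)

text \<open>Expand the last \<open>a\<close> as \<open>x * a * w * a\<close>; the resulting factor
  \<open>a * w * x ^ 2\<close> collapses to \<open>x\<close>, leaving
  \<open>x * a * w * a = a\<close>.\<close>

lemma w_core_inverse_inner:
  assumes "is_w_core_inverse w a x"
  shows "a * w * x * a = a"
proof -
  have "a * w * x * a = a * w * x * (x * a * w * a)"
    using assms by (simp add: is_w_core_inverse_def)
  also have "\<dots> = (a * w * x ^ 2) * a * w * a"
    by (simp add: mult.assoc power2_eq_square)
  also have "\<dots> = a"
    using assms by (simp add: is_w_core_inverse_def)
  finally show ?thesis .
qed

lemma is_inverse_along_w_core:
  assumes "is_w_core_inverse w a x"
  shows "is_inverse_along w a (x * a)"
proof -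
  \<comment> \<open>Right multiplication of \<open>x = a * w * x ^ 2\<close> by \<open>a\<close>
    puts \<open>x * a\<close> in the right ideal generated by \<open>a\<close>.\<close>
  have "x * a = a * (w * x ^ 2 * a)"
    using assms by (simp add: is_w_core_inverse_def flip: mult.assoc)
  then have "x * a \<in> range ((*) a) \<inter> range (\<lambda>s. s * a)"
    by blast
  moreover have "x * a * w * a = a"
    using assms by (simp add: is_w_core_inverse_def)
  moreover have "a * w * (x * a) = a"
    using w_core_inverse_inner[OF assms] by (simp add: mult.assoc)
  ultimately show ?thesis
    by (simp add: is_inverse_along_def)
qed

lemma is_13_inverse_w_core:
  assumes "is_w_core_inverse w a x"
  shows "is_13_inverse a (w * x)"
  using assms w_core_inverse_inner[OF assms]
  by (simp add: is_13_inverse_def is_w_core_inverse_def mult.assoc)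

text \<open>As \<open>b\<close> lies in both one-sided ideals generated by \<open>a\<close>, it
  inherits from \<open>a * y * a = a\<close> that \<open>a * y\<close> fixes it from the left and
  \<open>y * a\<close> from the right.\<close>

lemma is_w_core_inverse_along_13:
  assumes b: "is_inverse_along w a b" and y: "is_13_inverse a y"
  shows "is_w_core_inverse w a (b * y)"
proof -
  obtain s t where s: "b = a * s" and t: "b = t * a"
    using b unfolding is_inverse_along_def by blast
  have aya: "a * y * a = a"
    using y by (simp add: is_13_inverse_def)
  have awby: "a * w * (b * y) = a * y"
    using b by (simp add: is_inverse_along_def flip: mult.assoc)
  have ayb: "a * y * b = b"
    using aya by (simp add: s flip: mult.assoc)
  have bya: "b * y * a = b"
    using aya by (simp add: t mult.assoc)
  have "a * w * (b * y) ^ 2 = (a * w * (b * y)) * (b * y)"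
    by (simp add: power2_eq_square mult.assoc)
  also have "\<dots> = b * y"
    unfolding awby using ayb by (simp flip: mult.assoc)
  finally have "a * w * (b * y) ^ 2 = b * y" .
  moreover have "b * y * a * w * a = a"
    unfolding bya using b by (simp add: is_inverse_along_def)
  moreover have "star (a * w * (b * y)) = a * w * (b * y)"
    unfolding awby using y by (simp add: is_13_inverse_def)
  ultimately show ?thesis
    unfolding is_w_core_inverse_def by blast
qed

theorem theorem2p6:
  fixes a w :: "'a::star_monoid"
  shows "(w_core_invertible w a \<longleftrightarrow>
            invertible_along w a \<and> (\<exists>y. is_13_inverse a y)) \<and>
         (w_core_invertible w a \<longrightarrow>
            (\<forall>y. is_13_inverse a y \<longrightarrow> w_core_inverse w a = inverse_along w a * y) \<and>
            inverse_along w a = w_core_inverse w a * a)"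
proof (intro conjI impI)
  show "w_core_invertible w a \<longleftrightarrow> invertible_along w a \<and> (\<exists>y. is_13_inverse a y)"
    unfolding w_core_invertible_def invertible_along_def
    by (blast intro: is_inverse_along_w_core is_13_inverse_w_core is_w_core_inverse_along_13)
next
  assume "w_core_invertible w a"
  then obtain x where x: "is_w_core_inverse w a x"
    by (auto simp: w_core_invertible_def)
  note b = is_inverse_along_w_core[OF x]
  show "inverse_along w a = w_core_inverse w a * a"
    by (simp add: inverse_along_eq[OF b] w_core_inverse_eq[OF x])
  show "\<forall>y. is_13_inverse a y \<longrightarrow> w_core_inverse w a = inverse_along w a * y"
    \<comment> \<open>For every {1,3}-inverse \<open>y\<close>, the product \<open>x * a * y\<close>
      is a w-core inverse, hence the unique one, so the choice of \<open>y\<close> does not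
      matter.\<close>
    using w_core_inverse_eq[OF is_w_core_inverse_along_13[OF b]]
    by (simp add: inverse_along_eq[OF b])
qed

end
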